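(* Let $\Gamma$ be a finitely generated group and let $Z\subset \mathrm{Sub}(\Gamma)$ be a uniformly recurrent subgroup. Then there exists a minimal $Z$-proper system $(X,\Gamma,\alpha)$ (that is, $Z$ is the stability system of the minimal system $(X,\Gamma,\alpha)$).
   Context: $\mathrm{Sub}(\Gamma)$ is the compact space of all subgroups of $\Gamma$ (with the topology inherited from $\{0,1\}^\Gamma$), on which $\Gamma$ acts by conjugation. A uniformly recurrent subgroup (URS) is a nonempty closed, conjugation-invariant subset $Z\subset\mathrm{Sub}(\Gamma)$ such that the action of $\Gamma$ on $Z$ is minimal (every orbit is dense in $Z$). A $\Gamma$-system $(X,\Gamma,\alpha)$ is a (nonempty) compact metric space $X$ with a homomorphism $\alpha:\Gamma\to\mathrm{Homeo}(X)$; it is minimal if every orbit is dense. For $x\in X$, $\mathrm{Stab}_\alpha(x)$ is the stabilizer of $x$ and $\mathrm{Stab}^0_\alpha(x)=\{\gamma\in\Gamma : \gamma \text{ fixes some neighborhood of } x \text{ pointwise}\}$. Let $X^0=\{x\in X: \mathrm{Stab}_\alpha(x)=\mathrm{Stab}_\alpha^0(x)\}$. The stability system of $(X,\Gamma,\alpha)$ is the closure of $\mathrm{Stab}_\alpha(X^0)=\{\mathrm{Stab}_\alpha(x):x\in X^0\}$ in $\mathrm{Sub}(\Gamma)$. For a URS $Z$, the system $(X,\Gamma,\alpha)$ is $Z$-proper if for every $x\in X$: $\mathrm{Stab}_\alpha(x)=\mathrm{Stab}^0_\alpha(x)$ and $\mathrm{Stab}_\alpha(x)\in Z$. *)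

theory Defs
  imports "HOL-Analysis.Analysis" "HOL-Algebra.Group_Action" "HOL-Algebra.Generated_Groups"
begin

definition finitely_generated :: "('a, 'b) monoid_scheme \<Rightarrow> bool" where
  "finitely_generated G \<longleftrightarrow>
     (\<exists>S. finite S \<and> S \<subseteq> carrier G \<and> generate G S = carrier G)"

text \<open>Each subgroup is identified with its indicator function on the carrier, and the product
  topology on the space of functions from the carrier to the discrete two-point space
  is pulled back along this (injective) map.\<close>

definition Sub_topology :: "('a, 'b) monoid_scheme \<Rightarrow> 'a set topology" where
  "Sub_topology G =
     pullback_topology {H. subgroup H G} (\<lambda>H. \<lambda>g\<in>carrier G. g \<in> H)
       (product_topology (\<lambda>_. discrete_topology (UNIV :: bool set)) (carrier G))"

definition conj_action :: "('a, 'b) monoid_scheme \<Rightarrow> 'a \<Rightarrow> 'a set \<Rightarrow> 'a set" where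
  "conj_action G = (\<lambda>g. \<lambda>H\<in>{H. subgroup H G}. g <#\<^bsub>G\<^esub> H #>\<^bsub>G\<^esub> inv\<^bsub>G\<^esub> g)"

definition minimal_action ::
    "('a, 'b) monoid_scheme \<Rightarrow> 'x topology \<Rightarrow> ('a \<Rightarrow> 'x \<Rightarrow> 'x) \<Rightarrow> bool" where
  "minimal_action G T \<phi> \<longleftrightarrow>
     (\<forall>x\<in>topspace T. T closure_of (orbit G \<phi> x) = topspace T)"

definition URS :: "('a, 'b) monoid_scheme \<Rightarrow> 'a set set \<Rightarrow> bool" where
  "URS G Z \<longleftrightarrow>
     Z \<noteq> {} \<and> closedin (Sub_topology G) Z \<and>
     (\<forall>g\<in>carrier G. \<forall>H\<in>Z. conj_action G g H \<in> Z) \<and>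
     minimal_action G (subtopology (Sub_topology G) Z) (conj_action G)"

definition gamma_system ::
    "('a, 'b) monoid_scheme \<Rightarrow> 'x metric \<Rightarrow> ('a \<Rightarrow> 'x \<Rightarrow> 'x) \<Rightarrow> bool" where
  "gamma_system G M \<alpha> \<longleftrightarrow>
     mspace M \<noteq> {} \<and> compact_space (mtopology_of M) \<and>
     group_action G (mspace M) \<alpha> \<and>
     (\<forall>g\<in>carrier G. homeomorphic_map (mtopology_of M) (mtopology_of M) (\<alpha> g))"

definition minimal_system ::
    "('a, 'b) monoid_scheme \<Rightarrow> 'x metric \<Rightarrow> ('a \<Rightarrow> 'x \<Rightarrow> 'x) \<Rightarrow> bool" where
  "minimal_system G M \<alpha> \<longleftrightarrow> gamma_system G M \<alpha> \<and> minimal_action G (mtopology_of M) \<alpha>"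

definition stabilizer0 ::
    "('a, 'b) monoid_scheme \<Rightarrow> 'x metric \<Rightarrow> ('a \<Rightarrow> 'x \<Rightarrow> 'x) \<Rightarrow> 'x \<Rightarrow> 'a set" where
  "stabilizer0 G M \<alpha> x =
     {g \<in> carrier G. \<exists>U. openin (mtopology_of M) U \<and> x \<in> U \<and> (\<forall>y\<in>U. \<alpha> g y = y)}"

definition stability_system ::
    "('a, 'b) monoid_scheme \<Rightarrow> 'x metric \<Rightarrow> ('a \<Rightarrow> 'x \<Rightarrow> 'x) \<Rightarrow> 'a set set" where
  "stability_system G M \<alpha> =
     Sub_topology G closure_of
       (stabilizer G \<alpha> ` {x \<in> mspace M. stabilizer G \<alpha> x = stabilizer0 G M \<alpha> x})"

definition proper_system ::
    "('a, 'b) monoid_scheme \<Rightarrow> 'a set set \<Rightarrow> 'x metric \<Rightarrow> ('a \<Rightarrow> 'x \<Rightarrow> 'x) \<Rightarrow> bool" where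
  "proper_system G Z M \<alpha> \<longleftrightarrow>
     gamma_system G M \<alpha> \<and>
     (\<forall>x\<in>mspace M. stabilizer G \<alpha> x = stabilizer0 G M \<alpha> x \<and> stabilizer G \<alpha> x \<in> Z)"

text \<open>HOL cannot quantify existentially over types, so a claim that some system exists has to fix
  the type of its points. Taking subsets of \<^typ>\<open>real\<close> with an arbitrary metric (unrelated to the
  usual distance) loses no generality: a compact metric space has at most the cardinality of the
  continuum, so every system is isometrically isomorphic to one whose points are reals.\<close>

end

theory Submission
  imports Defs
begin

text \<open>Fix \<open>H \<in> Z\<close>. For each \<open>k \<in> \<Gamma>\<close>, translation by \<open>k\<close> permutes the cosets \<open>hH\<close>, so the graph with edges
  \<open>hH - khH\<close> has degree at most two and the cosets admit a colouring \<open>q\<^sub>k\<close> with three colours that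
  separates \<open>hH\<close> from \<open>khH\<close> whenever they differ. The configuration \<open>c (k, h) = q\<^sub>k (hH)\<close> lies in the
  compact metrizable space of all maps \<open>\<Gamma> \<times> \<Gamma> \<rightarrow> {0, 1, 2}\<close>, on which \<open>\<Gamma>\<close> acts by right translation of
  the second argument, and its stabilizer is \<open>H\<close>. On every translate \<open>c'\<close> of \<open>c\<close>, and hence on the
  orbit closure, \<open>k\<close> fixes \<open>c'\<close> if and only if \<open>c' (k, k) = c' (k, 1)\<close>. This condition is clopen, so
  there the stabilizer map is continuous and stabilizers fix neighbourhoods pointwise. Any minimal
  subsystem of the configurations with this property and with stabilizer in \<open>Z\<close> is as required; its
  stability system is all of \<open>Z\<close> because \<open>Z\<close> is minimal.\<close>

subsection \<open>Colourings along an injection\<close>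

text \<open>Colour greedily along a well-order of the type. The only possible neighbours of a vertex
  are its image and its preimage under \<open>f\<close>, so at most two colours are forbidden and
  three suffice, whatever the length of the \<open>f\<close>-orbits.\<close>

lemma injection_three_coloring:
  assumes "inj_on f V" and "f ` V \<subseteq> V"
  obtains c :: "'v \<Rightarrow> nat"
  where "\<And>v. c v < 3" and "\<And>v. v \<in> V \<Longrightarrow> c (f v) = c v \<Longrightarrow> f v = v"
proof -
  obtain R :: "'v rel" where R: "well_order_on UNIV R"
    using well_order_on[of "UNIV :: 'v set"] by (elim exE)
  have wf: "wf (R - Id)"
    using R by (simp add: well_order_on_def)
  have total: "(x, y) \<in> R - Id \<or> (y, x) \<in> R - Id" if "x \<noteq> y" for x y
    using R that by (auto simp: well_order_on_def linear_order_on_def total_on_def)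
  define adj where "adj x y \<longleftrightarrow> (x \<in> V \<and> y = f x) \<or> (y \<in> V \<and> x = f y)" for x y
  \<comment> \<open>Only strictly earlier neighbours are constrained. Hence \<open>P c x\<close>
    depends on \<open>c\<close> below \<open>x\<close> alone, as the recursive choice requires, and
    a fixed point of \<open>f\<close> is never its own obstacle.\<close>
  define P where "P c x r \<longleftrightarrow> r < 3 \<and> (\<forall>y. (y, x) \<in> R - Id \<and> adj x y \<longrightarrow> c y \<noteq> r)"
    for c :: "'v \<Rightarrow> nat" and x r
  have "\<exists>c. \<forall>x. P c x (c x)"
  proof (rule dependent_wf_choice[OF wf])
    show "P c x r = P d x r" if "\<And>z. (z, x) \<in> R - Id \<Longrightarrow> c z = d z" for c d x r
      using that unfolding P_def by metis
    fix x and c :: "'v \<Rightarrow> nat"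
    \<comment> \<open>The preimage of \<open>x\<close> in \<open>V\<close> if there is one, unique
      by injectivity. Otherwise \<open>p\<close> is arbitrary, and avoiding its colour does no
      harm.\<close>
    define p where "p = (THE y. y \<in> V \<and> x = f y)"
    have p: "y = p" if "y \<in> V" "x = f y" for y
      unfolding p_def using that assms(1) by (intro the_equality[symmetric]) (auto dest: inj_onD)
    have "card {c (f x), c p} < card {..<3::nat}"
      by (rule le_less_trans[OF card_insert_le_m1[of 2]]) auto
    then have "\<not> {..<3} \<subseteq> {c (f x), c p}"
      by (metis card_mono finite.emptyI finite.insertI not_less)
    then obtain r where "r < 3" "r \<noteq> c (f x)" "r \<noteq> c p"
      by blast
    then have "P c x r"
      unfolding P_def adj_def using p by blast
    then show "\<exists>r. P c x r" ..
  qed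
  then obtain c where c: "\<And>x. P c x (c x)" by blast
  show thesis
  proof (rule that)
    show "c v < 3" for v
      using c P_def by blast
    fix v assume v: "v \<in> V" "c (f v) = c v"
    show "f v = v"
    proof (rule ccontr)
      assume "f v \<noteq> v"
      then consider "(f v, v) \<in> R - Id" | "(v, f v) \<in> R - Id"
        using total by blast
      then show False
        using c[of v] c[of "f v"] v unfolding P_def adj_def by cases metis+
    qed
  qed
qed

subsection \<open>Continuous actions on topological spaces\<close>

text \<open>Nothing is demanded of \<open>\<phi>\<close> outside the space, so the same
  \<open>\<phi>\<close> acts on every invariant subspace. Restriction to the space, as
  \<open>group_action\<close> wants it, is postponed to
  \<open>restrict_group_action\<close>.\<close>

locale top_action = group G for G (structure) +
  fixes T :: "'x topology" and \<phi> :: "'a \<Rightarrow> 'x \<Rightarrow> 'x"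
  assumes continuous: "g \<in> carrier G \<Longrightarrow> continuous_map T T (\<phi> g)"
    and act_one: "x \<in> topspace T \<Longrightarrow> \<phi> \<one> x = x"
    and act_mult: "\<lbrakk>g \<in> carrier G; h \<in> carrier G; x \<in> topspace T\<rbrakk> \<Longrightarrow> \<phi> (g \<otimes> h) x = \<phi> g (\<phi> h x)"
begin

lemma act_closed: "g \<in> carrier G \<Longrightarrow> x \<in> topspace T \<Longrightarrow> \<phi> g x \<in> topspace T"
  using continuous by (auto simp: continuous_map_def)

lemma act_inv:
  "g \<in> carrier G \<Longrightarrow> x \<in> topspace T \<Longrightarrow> \<phi> (inv g) (\<phi> g x) = x"
  "g \<in> carrier G \<Longrightarrow> x \<in> topspace T \<Longrightarrow> \<phi> g (\<phi> (inv g) x) = x"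
  by (simp_all add: act_one flip: act_mult)

lemma subaction:
  assumes "\<And>g x. g \<in> carrier G \<Longrightarrow> x \<in> X \<inter> topspace T \<Longrightarrow> \<phi> g x \<in> X"
  shows "top_action G (subtopology T X) \<phi>"
proof
  show "continuous_map (subtopology T X) (subtopology T X) (\<phi> g)" if "g \<in> carrier G" for g
    using assms that
    by (auto simp: continuous_map_in_subtopology intro: continuous continuous_map_from_subtopology)
qed (auto simp: act_one act_mult)

lemma homeomorphic: "g \<in> carrier G \<Longrightarrow> homeomorphic_map T T (\<phi> g)"
  unfolding homeomorphic_map_maps homeomorphic_maps_def
  by (rule exI[of _ "\<phi> (inv g)"]) (simp add: continuous act_inv)

lemma restrict_group_action: "group_action G (topspace T) (\<lambda>g. restrict (\<phi> g) (topspace T))"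
  unfolding group_action_def group_hom_def group_hom_axioms_def
proof (intro conjI)
  show "group G" by (rule is_group)
  show "group (BijGroup (topspace T))" by (rule group_BijGroup)
  have bij: "restrict (\<phi> g) (topspace T) \<in> Bij (topspace T)" if "g \<in> carrier G" for g
    using homeomorphic[OF that] by (simp add: Bij_def homeomorphic_eq_everything_map bij_betw_def)
  show "(\<lambda>g. restrict (\<phi> g) (topspace T)) \<in> hom G (BijGroup (topspace T))"
    unfolding hom_def using bij
    by (auto simp: BijGroup_def compose_def act_mult act_closed intro!: restrict_ext)
qed

text \<open>An element \<open>k\<close> fixes \<open>\<phi> g x\<close> iff its conjugate
  \<open>inv g \<otimes> k \<otimes> g\<close> fixes \<open>x\<close>. The subgroup assumption puts
  the stabilizer into the domain to which \<open>conj_action\<close> is restricted.\<close>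

lemma stabilizer_conj:
  assumes g: "g \<in> carrier G" and x: "x \<in> topspace T" and sub: "subgroup (stabilizer G \<phi> x) G"
  shows "stabilizer G \<phi> (\<phi> g x) = conj_action G g (stabilizer G \<phi> x)"
proof -
  have *: "\<phi> k (\<phi> g x) = \<phi> g x \<longleftrightarrow> \<phi> (inv g \<otimes> k \<otimes> g) x = x" if "k \<in> carrier G" for k
    using g x that by (simp add: act_mult act_closed) (metis act_closed act_inv)
  have "k \<in> stabilizer G \<phi> (\<phi> g x) \<longleftrightarrow> k \<in> g <# stabilizer G \<phi> x #> inv g" for k
  proof
    assume "k \<in> stabilizer G \<phi> (\<phi> g x)"
    then have k: "k \<in> carrier G" "inv g \<otimes> k \<otimes> g \<in> stabilizer G \<phi> x"
      using * g by (auto simp: stabilizer_def)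
    have "k = g \<otimes> (inv g \<otimes> k \<otimes> g) \<otimes> inv g"
      using k g inv_solve_left[of "inv g \<otimes> k" g k] by (simp add: m_assoc)
    then show "k \<in> g <# stabilizer G \<phi> x #> inv g"
      using k unfolding l_coset_def r_coset_def by blast
  next
    assume "k \<in> g <# stabilizer G \<phi> x #> inv g"
    then obtain h where h: "h \<in> stabilizer G \<phi> x" "k = g \<otimes> h \<otimes> inv g"
      unfolding l_coset_def r_coset_def by blast
    then have hc: "h \<in> carrier G" "\<phi> h x = x" by (auto simp: stabilizer_def)
    have "inv g \<otimes> k \<otimes> g = h"
      using hc g h(2) by (simp add: m_assoc inv_solve_left')
    then show "k \<in> stabilizer G \<phi> (\<phi> g x)"
      using * hc h(2) g by (simp add: stabilizer_def)
  qed
  then show ?thesis using sub by (auto simp: conj_action_def)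
qed

text \<open>Zorn's lemma for nonempty closed invariant sets under reverse inclusion; compactness
  bounds the chains. In a set that contains no smaller one, every orbit closure is again such a set
  and therefore everything.\<close>

lemma ex_minimal_invariant:
  assumes compact: "compact_space T" and ne: "topspace T \<noteq> {}"
  obtains X where "closedin T X" "X \<noteq> {}" "\<And>g x. g \<in> carrier G \<Longrightarrow> x \<in> X \<Longrightarrow> \<phi> g x \<in> X"
    "minimal_action G (subtopology T X) \<phi>"
proof -
  define \<A> where "\<A> = {C. closedin T C \<and> C \<noteq> {} \<and> (\<forall>g\<in>carrier G. \<phi> g ` C \<subseteq> C)}"
  have "\<exists>X\<in>\<A>. \<forall>Y\<in>\<A>. X \<supseteq> Y \<longrightarrow> Y = X"
  proof (rule predicate_Zorn)
    show "partial_order_on \<A> (relation_of (\<supseteq>) \<A>)"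
      by (rule partial_order_on_relation_ofI) auto
    fix \<C> assume "\<C> \<in> Chains (relation_of (\<supseteq>) \<A>)"
    then have \<C>: "\<C> \<subseteq> \<A>" "\<And>A B. A \<in> \<C> \<Longrightarrow> B \<in> \<C> \<Longrightarrow> A \<subseteq> B \<or> B \<subseteq> A"
      by (auto simp: Chains_def relation_of_def)
    show "\<exists>U\<in>\<A>. \<forall>A\<in>\<C>. A \<supseteq> U"
    proof (cases "\<C> = {}")
      case True
      have "topspace T \<in> \<A>"
        using ne by (auto simp: \<A>_def act_closed)
      then show ?thesis using True by blast
    next
      case False
      \<comment> \<open>A nonempty finite subfamily of a chain has a least member, which is its
        intersection. This yields the finite intersection property for \<open>\<C>\<close>.\<close>
      have fin: "\<F> \<noteq> {} \<Longrightarrow> \<Inter>\<F> \<in> \<F>" if "finite \<F>" "\<F> \<subseteq> \<C>" for \<F>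
        using that
      proof (induction rule: finite_induct)
        case (insert A \<F>)
        show ?case
        proof (cases "\<F> = {}")
          case ne: False
          then have "\<Inter>\<F> \<in> \<F>" using insert by blast
          then have "A \<subseteq> \<Inter>\<F> \<or> \<Inter>\<F> \<subseteq> A" using insert \<C>(2) by blast
          then have "A \<inter> \<Inter>\<F> = A \<or> A \<inter> \<Inter>\<F> = \<Inter>\<F>"
            by (auto simp only: Int_absorb1 Int_absorb2)
          then show ?thesis
            by (rule disjE) (simp_all add: \<open>\<Inter>\<F> \<in> \<F>\<close>)
        qed auto
      qed auto
      have "\<Inter>\<C> \<noteq> {}"
      proof (rule compact[unfolded compact_space_fip, rule_format], intro conjI ballI allI impI)
        show "closedin T C" if "C \<in> \<C>" for C
          using that \<C> by (auto simp: \<A>_def)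
        show "\<Inter>\<F> \<noteq> {}" if "finite \<F> \<and> \<F> \<subseteq> \<C>" for \<F>
          using fin[of \<F>] that \<C>(1) by (cases "\<F> = {}") (auto simp: \<A>_def)
      qed
      moreover have "closedin T (\<Inter>\<C>)"
        using False \<C>(1) by (intro closedin_Inter) (auto simp: \<A>_def)
      moreover have "\<phi> g ` \<Inter>\<C> \<subseteq> \<Inter>\<C>" if "g \<in> carrier G" for g
        using that \<C>(1) unfolding \<A>_def by blast
      ultimately have "\<Inter>\<C> \<in> \<A>" by (simp add: \<A>_def)
      then show ?thesis by blast
    qed
  qed
  then obtain X where X: "X \<in> \<A>" and min: "\<And>Y. Y \<in> \<A> \<Longrightarrow> Y \<subseteq> X \<Longrightarrow> Y = X"
    by blast
  then have cl: "closedin T X" and inv: "\<And>g x. g \<in> carrier G \<Longrightarrow> x \<in> X \<Longrightarrow> \<phi> g x \<in> X"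
    by (auto simp: \<A>_def)
  have XT: "X \<subseteq> topspace T" using cl closedin_subset by blast
  have "T closure_of orbit G \<phi> x = X" if x: "x \<in> X" for x
  proof (rule min)
    have orb: "orbit G \<phi> x \<subseteq> X" using inv x by (auto simp: orbit_def)
    then show "T closure_of orbit G \<phi> x \<subseteq> X" by (rule closure_of_minimal[OF _ cl])
    have "\<phi> \<one> x \<in> orbit G \<phi> x" unfolding orbit_def by blast
    then have ne: "T closure_of orbit G \<phi> x \<noteq> {}"
      using orb XT by (metis closure_of_subset empty_iff subset_iff)
    have "\<phi> g ` (T closure_of orbit G \<phi> x) \<subseteq> T closure_of orbit G \<phi> x" if g: "g \<in> carrier G" for g
    proof -
      have "\<phi> g ` orbit G \<phi> x \<subseteq> orbit G \<phi> x"
      proof clarify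
        fix y assume "y \<in> orbit G \<phi> x"
        then obtain h where h: "h \<in> carrier G" "y = \<phi> h x" by (auto simp: orbit_def)
        then have "\<phi> g y = \<phi> (g \<otimes> h) x" using g x XT by (auto simp: act_mult)
        then show "\<phi> g y \<in> orbit G \<phi> x" using g h(1) unfolding orbit_def by blast
      qed
      then show ?thesis
        using continuous_map_image_closure_subset[OF continuous[OF g], of "orbit G \<phi> x"]
          closure_of_mono by blast
    qed
    with ne show "T closure_of orbit G \<phi> x \<in> \<A>" by (simp add: \<A>_def)
  qed
  moreover have "orbit G \<phi> x \<subseteq> X" if "x \<in> X" for x
    using inv that by (auto simp: orbit_def)
  ultimately have "minimal_action G (subtopology T X) \<phi>"
    using XT by (simp add: minimal_action_def closure_of_subtopology Int_absorb1 Int_absorb2)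
  then show thesis using that X cl inv by (auto simp: \<A>_def)
qed


text \<open>Passes from an abstract space to a metric on a set of reals. Open fixed-point sets,
  assumption \<open>opn\<close>, make each stabilizer element act trivially near the point. All
  points are then stable, and the stabilizers contain a whole conjugation orbit, which is dense in
  \<open>Z\<close>.\<close>

lemma ex_real_proper_system:
  assumes compact: "compact_space T" and metrizable: "metrizable_space T"
    and ne: "topspace T \<noteq> {}" and small: "topspace T \<lesssim> (UNIV :: real set)"
    and minimal: "minimal_action G T \<phi>"
    and opn: "\<And>g. g \<in> carrier G \<Longrightarrow> openin T {x \<in> topspace T. \<phi> g x = x}"
    and stab: "\<And>x. x \<in> topspace T \<Longrightarrow> stabilizer G \<phi> x \<in> Z"
    and Z: "URS G Z"
  shows "\<exists>(M :: real metric) \<alpha>.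
           minimal_system G M \<alpha> \<and> proper_system G Z M \<alpha> \<and> stability_system G M \<alpha> = Z"
proof -
  obtain f :: "'x \<Rightarrow> real" where f: "inj_on f (topspace T)"
    using small by (auto simp: lepoll_def)
  define J where "J = f ` topspace T"
  define e where "e = inv_into (topspace T) f"
  \<comment> \<open>The topology of \<open>T\<close> carried over to \<open>J\<close> along the
    bijection \<open>e\<close>; it has nothing to do with the usual topology of the reals.\<close>
  define Y where "Y = pullback_topology J e T"
  have fe: "f (e y) = y" "e y \<in> topspace T" if "y \<in> J" for y
    using that by (auto simp: J_def e_def f_inv_into_f inv_into_into)
  have ef: "e (f x) = x" "f x \<in> J" if "x \<in> topspace T" for x
    using that f by (auto simp: J_def e_def)
  have topY: "topspace Y = J"
    using fe by (auto simp: Y_def topspace_pullback_topology)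
  have cont_e: "continuous_map Y T e"
    unfolding Y_def using continuous_map_pullback[of T T id J e] by simp
  have cont_f: "continuous_map T Y f"
    unfolding Y_def
  proof (rule continuous_map_pullback')
    show "continuous_map T T (e \<circ> f)"
      by (rule continuous_map_eq[of _ _ id]) (auto simp: ef)
  qed (auto simp: ef)
  have hom: "homeomorphic_maps T Y f e"
    using cont_e cont_f fe ef by (simp add: homeomorphic_maps_def topY)
  then have "T homeomorphic_space Y"
    unfolding homeomorphic_space_def by blast
  then have Y: "compact_space Y" "metrizable_space Y"
    using compact metrizable homeomorphic_compact_space homeomorphic_metrizable_space by blast+
  then obtain J' d where "Metric_space J' d" "Y = Metric_space.mtopology J' d"
    unfolding metrizable_space_def by blast
  then obtain M where M: "mtopology_of M = Y"
    by (metis Metric_space.mtopology_of)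
  then have spM: "mspace M = J"
    using topY topspace_mtopology_of by metis
  define \<psi> where "\<psi> g y = f (\<phi> g (e y))" for g y
  interpret R: top_action G Y \<psi>
  proof
    show "continuous_map Y Y (\<psi> g)" if "g \<in> carrier G" for g
      unfolding \<psi>_def using that
      by (intro continuous_map_compose[OF _ cont_f, unfolded o_def]
          continuous_map_compose[OF cont_e, unfolded o_def] continuous)
  qed (auto simp: topY \<psi>_def act_one act_mult act_closed fe ef)
  \<comment> \<open>Bijections in \<open>BijGroup\<close> are extensional, hence the restriction to
    \<open>J\<close>.\<close>
  define \<alpha> where "\<alpha> g = restrict (\<psi> g) J" for g
  have \<alpha>: "\<alpha> g y = \<psi> g y" if "y \<in> J" for g y
    using that by (simp add: \<alpha>_def)
  have fixes_iff: "\<psi> g y = y \<longleftrightarrow> \<phi> g (e y) = e y" if "g \<in> carrier G" "y \<in> J" for g y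
    using that fe ef act_closed unfolding \<psi>_def by metis
  have sys: "gamma_system G M \<alpha>"
    unfolding gamma_system_def
  proof (intro conjI ballI)
    show "mspace M \<noteq> {}" using ne by (simp add: spM J_def)
    show "compact_space (mtopology_of M)" by (simp add: M Y)
    show "group_action G (mspace M) \<alpha>"
      using R.restrict_group_action by (simp add: spM topY \<alpha>_def[abs_def])
    show "homeomorphic_map (mtopology_of M) (mtopology_of M) (\<alpha> g)" if "g \<in> carrier G" for g
      using homeomorphic_map_eq[OF R.homeomorphic[OF that]] by (simp add: M topY \<alpha>)
  qed
  have orb: "orbit G \<alpha> y = f ` orbit G \<phi> (e y)" if "y \<in> J" for y
    using that by (auto simp: orbit_def \<alpha> \<psi>_def)
  have "minimal_action G Y \<alpha>"
    unfolding minimal_action_def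
  proof
    fix y assume "y \<in> topspace Y"
    then have y: "y \<in> J" by (simp add: topY)
    have "orbit G \<phi> (e y) \<subseteq> topspace T"
      using fe[OF y] act_closed by (auto simp: orbit_def)
    then have "Y closure_of (orbit G \<alpha> y) = f ` (T closure_of (orbit G \<phi> (e y)))"
      unfolding orb[OF y]
      using hom homeomorphic_map_closure_of homeomorphic_maps_map by blast
    also have "\<dots> = topspace Y"
      using minimal fe[OF y] by (simp add: minimal_action_def topY J_def)
    finally show "Y closure_of (orbit G \<alpha> y) = topspace Y" .
  qed
  then have min: "minimal_system G M \<alpha>"
    using sys by (simp add: minimal_system_def M)
  have st: "stabilizer G \<alpha> y = stabilizer G \<phi> (e y)" if "y \<in> J" for y
    using that fixes_iff by (auto simp: stabilizer_def \<alpha>)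
  have st0: "stabilizer G \<alpha> y = stabilizer0 G M \<alpha> y" if y: "y \<in> J" for y
  proof
    show "stabilizer0 G M \<alpha> y \<subseteq> stabilizer G \<alpha> y"
      by (auto simp: stabilizer_def stabilizer0_def)
    show "stabilizer G \<alpha> y \<subseteq> stabilizer0 G M \<alpha> y"
    proof
      fix g assume "g \<in> stabilizer G \<alpha> y"
      then have g: "g \<in> carrier G" "\<alpha> g y = y" by (auto simp: stabilizer_def)
      \<comment> \<open>The preimage under \<open>e\<close> of the open fixed-point set of
        \<open>g\<close> is the neighbourhood of \<open>y\<close> that \<open>stabilizer0\<close>
        asks for.\<close>
      have "openin Y {y \<in> topspace Y. e y \<in> {x \<in> topspace T. \<phi> g x = x}}"
        by (rule openin_continuous_map_preimage[OF cont_e opn[OF g(1)]])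
      then show "g \<in> stabilizer0 G M \<alpha> y"
        unfolding stabilizer0_def M using g y
        by (auto simp: topY \<alpha> fixes_iff fe intro!: exI[of _ "{y \<in> J. \<phi> g (e y) = e y}"]
            cong: conj_cong)
    qed
  qed
  have stZ: "stabilizer G \<alpha> y \<in> Z" if "y \<in> J" for y
    using that st stab fe by simp
  have proper: "proper_system G Z M \<alpha>"
    using sys st0 stZ by (simp add: proper_system_def spM)
  have clZ: "closedin (Sub_topology G) Z" using Z by (simp add: URS_def)
  have stable_points: "{x \<in> mspace M. stabilizer G \<alpha> x = stabilizer0 G M \<alpha> x} = J"
    using st0 by (auto simp: spM)
  have "stability_system G M \<alpha> = Z"
    unfolding stability_system_def stable_points
  proof
    show "Sub_topology G closure_of (stabilizer G \<alpha> ` J) \<subseteq> Z"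
      by (rule closure_of_minimal[OF _ clZ]) (use stZ in auto)
    obtain x where x: "x \<in> topspace T" using ne by blast
    define H where "H = stabilizer G \<phi> x"
    have ZT: "Z \<subseteq> topspace (Sub_topology G)" by (rule closedin_subset[OF clZ])
    have HZ: "H \<in> Z" using stab x by (simp add: H_def)
    then have subH: "subgroup H G"
      using ZT by (auto simp: Sub_topology_def topspace_pullback_topology)
    \<comment> \<open>Moving a point by \<open>g\<close> conjugates its stabilizer, so all
      conjugates of \<open>H\<close> occur as stabilizers.\<close>
    have "orbit G (conj_action G) H \<subseteq> stabilizer G \<alpha> ` J"
    proof
      fix K assume "K \<in> orbit G (conj_action G) H"
      then obtain g where g: "g \<in> carrier G" "K = conj_action G g H"
        by (auto simp: orbit_def)
      then have "K = stabilizer G \<phi> (\<phi> g x)"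
        using stabilizer_conj[OF g(1) x] subH by (simp add: H_def)
      also have "\<dots> = stabilizer G \<alpha> (f (\<phi> g x))"
        using act_closed[OF g(1) x] by (simp add: st ef)
      finally show "K \<in> stabilizer G \<alpha> ` J"
        using act_closed[OF g(1) x] ef by blast
    qed
    then have "Sub_topology G closure_of (orbit G (conj_action G) H)
        \<subseteq> Sub_topology G closure_of (stabilizer G \<alpha> ` J)"
      by (rule closure_of_mono)
    moreover have "Z \<subseteq> Sub_topology G closure_of (orbit G (conj_action G) H)"
    proof -
      have "subtopology (Sub_topology G) Z closure_of (orbit G (conj_action G) H) = Z"
        using Z HZ unfolding URS_def minimal_action_def topspace_subtopology_subset[OF ZT] by blast
      then show ?thesis using closure_of_subtopology_subset by metis
    qed
    ultimately show "Z \<subseteq> Sub_topology G closure_of (stabilizer G \<alpha> ` J)" by blast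
  qed
  with min proper show ?thesis by blast
qed

end

subsection \<open>Colourings of a group\<close>

definition config_space :: "('a, 'b) monoid_scheme \<Rightarrow> ('a \<times> 'a \<Rightarrow> nat) topology" where
  "config_space G = product_topology (\<lambda>_. discrete_topology {..<3}) (carrier G \<times> carrier G)"

text \<open>Translating the argument on the right gives a left action: applying
  \<open>shift G l\<close> after \<open>shift G m\<close> evaluates \<open>c\<close> at
  \<open>h \<otimes> l \<otimes> m\<close>.\<close>

definition shift :: "('a, 'b) monoid_scheme \<Rightarrow> 'a \<Rightarrow> ('a \<times> 'a \<Rightarrow> nat) \<Rightarrow> 'a \<times> 'a \<Rightarrow> nat" where
  "shift G l c = (\<lambda>(k, h)\<in>carrier G \<times> carrier G. c (k, h \<otimes>\<^bsub>G\<^esub> l))"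

text \<open>Closedness of this condition is what makes stabilizers locally constant in the limit: whether
  \<open>k\<close> fixes a configuration is decided by two of its entries.\<close>

definition rigid :: "('a, 'b) monoid_scheme \<Rightarrow> ('a \<times> 'a \<Rightarrow> nat) set" where
  "rigid G = {c \<in> topspace (config_space G). \<forall>k\<in>carrier G. \<forall>l\<in>carrier G.
     c (k, k \<otimes>\<^bsub>G\<^esub> l) = c (k, l) \<longrightarrow>
       (\<forall>g\<in>carrier G. \<forall>h\<in>carrier G. c (g, h \<otimes>\<^bsub>G\<^esub> k \<otimes>\<^bsub>G\<^esub> l) = c (g, h \<otimes>\<^bsub>G\<^esub> l))}"

section \<open>Topology of the configuration space\<close>

lemma topspace_config_space:
  "topspace (config_space G) = (carrier G \<times> carrier G) \<rightarrow>\<^sub>E {..<3}"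
  by (simp add: config_space_def)

lemma compact_config_space: "compact_space (config_space G)"
  by (simp add: config_space_def compact_space_product_topology compact_space_discrete_topology)

lemma metrizable_config_space:
  "countable (carrier G) \<Longrightarrow> metrizable_space (config_space G)"
  unfolding config_space_def metrizable_space_product_topology
  by (auto intro: countable_subset[of _ "carrier G \<times> carrier G"])

text \<open>Each entry takes one of three values, so equality and inequality of two entries are both
  finite unions of open cylinder sets.\<close>

lemma clopen_config_entries_eq:
  assumes "i \<in> carrier G \<times> carrier G" "j \<in> carrier G \<times> carrier G"
  shows "openin (config_space G) {c \<in> topspace (config_space G). c i = c j}"
    and "closedin (config_space G) {c \<in> topspace (config_space G). c i = c j}"
proof -
  have entry: "openin (config_space G) {c \<in> topspace (config_space G). c i \<in> S}"
    if "i \<in> carrier G \<times> carrier G" "S \<subseteq> {..<3}" for i S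
    unfolding config_space_def
    by (rule openin_continuous_map_preimage[OF continuous_map_product_projection]) (use that in auto)
  have pair: "openin (config_space G)
      ({c \<in> topspace (config_space G). c i \<in> S} \<inter> {c \<in> topspace (config_space G). c j \<in> S'})"
    if "S \<subseteq> {..<3}" "S' \<subseteq> {..<3}" for S S'
    using that assms entry by blast
  have less: "c i \<in> {..<3}" "c j \<in> {..<3}" if "c \<in> topspace (config_space G)" for c
    using that assms by (auto simp: topspace_config_space PiE_iff)
  \<comment> \<open>\<open>S v\<close> lists the values allowed for the second entry when the first
    is \<open>v\<close>: \<open>{v}\<close> for equality, its complement in \<open>{..<3}\<close>
    for inequality.\<close>
  have Un: "openin (config_space G) (\<Union>v\<in>{..<3}. {c \<in> topspace (config_space G). c i \<in> {v}} \<inter>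
      {c \<in> topspace (config_space G). c j \<in> S v})" if "\<And>v. v < 3 \<Longrightarrow> S v \<subseteq> {..<3}" for S
    by (rule openin_Union, clarify, rule pair) (use that in force)+
  have "{c \<in> topspace (config_space G). c i = c j} =
      (\<Union>v\<in>{..<3}. {c \<in> topspace (config_space G). c i \<in> {v}} \<inter> {c \<in> topspace (config_space G). c j \<in> {v}})"
    using less by auto
  then show "openin (config_space G) {c \<in> topspace (config_space G). c i = c j}"
    using Un[of "\<lambda>v. {v}"] by (simp only:) simp
  have "topspace (config_space G) - {c \<in> topspace (config_space G). c i = c j} =
      (\<Union>v\<in>{..<3}. {c \<in> topspace (config_space G). c i \<in> {v}} \<inter>
        {c \<in> topspace (config_space G). c j \<in> {..<3} - {v}})"
    using less by auto
  then have "openin (config_space G) (topspace (config_space G) - {c \<in> topspace (config_space G). c i = c j})"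
    using Un[of "\<lambda>v. {..<3} - {v}"] by (simp only:) simp
  then show "closedin (config_space G) {c \<in> topspace (config_space G). c i = c j}"
    by (simp add: closedin_def)
qed

section \<open>Cardinality bounds\<close>

lemma countable_PiE_lepoll_real:
  assumes "countable I"
  shows "(I \<rightarrow>\<^sub>E (J :: nat set)) \<lesssim> (UNIV :: real set)"
proof -
  \<comment> \<open>The graph of a map is a subset of the countable set of pairs; enumerating the
    pairs turns it into a set of naturals, and these are as many as the reals.\<close>
  let ?g = "\<lambda>c. to_nat_on (I \<times> (UNIV :: nat set)) ` (\<lambda>i. (i, c i)) ` I"
  have cI: "countable (I \<times> (UNIV :: nat set))" using assms by simp
  have "inj_on ?g (I \<rightarrow>\<^sub>E J)"
  proof (rule inj_onI)
    fix c d assume c: "c \<in> I \<rightarrow>\<^sub>E J" "d \<in> I \<rightarrow>\<^sub>E J" and "?g c = ?g d"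
    then have eq: "(\<lambda>i. (i, c i)) ` I = (\<lambda>i. (i, d i)) ` I"
      by (subst (asm) inj_on_image_eq_iff[OF inj_on_to_nat_on[OF cI]]) auto
    show "c = d"
    proof (rule PiE_ext[OF c])
      fix i assume "i \<in> I"
      then have "(i, c i) \<in> (\<lambda>i. (i, d i)) ` I" using eq by blast
      then show "c i = d i" by auto
    qed
  qed
  then have "(I \<rightarrow>\<^sub>E J) \<lesssim> (UNIV :: nat set set)"
    by (auto simp: lepoll_def)
  then show ?thesis
    using nat_sets_eqpoll_reals lepoll_trans2 by blast
qed

context group
begin

text \<open>Elements of the generated subgroup are products of words in \<open>S\<close> and its
  inverses, and a countable alphabet has countably many words.\<close>

lemma countable_generate:
  assumes "countable S" "S \<subseteq> carrier G"
  shows "countable (generate G S)"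
proof (rule countable_subset)
  let ?L = "lists (S \<union> m_inv G ` S)"
  let ?p = "\<lambda>xs. foldr (\<otimes>) xs \<one>"
  have L: "set xs \<subseteq> carrier G" if "xs \<in> ?L" for xs
    using that assms(2) by (auto simp: in_lists_conv_set)
  have closed: "?p xs \<in> carrier G" if "set xs \<subseteq> carrier G" for xs
    using that by (induction xs) auto
  have app: "?p (xs @ ys) = ?p xs \<otimes> ?p ys" if "set xs \<subseteq> carrier G" "set ys \<subseteq> carrier G" for xs ys
    using that by (induction xs) (auto simp: m_assoc closed)
  show "generate G S \<subseteq> ?p ` ?L"
  proof
    fix x assume "x \<in> generate G S"
    then show "x \<in> ?p ` ?L"
    proof induction
      case one
      show ?case by (rule image_eqI[of _ _ "[]"]) auto
    next
      case (incl h)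
      then show ?case using assms(2) by (intro image_eqI[of _ _ "[h]"]) auto
    next
      case (inv h)
      then show ?case using assms(2) by (intro image_eqI[of _ _ "[inv h]"]) auto
    next
      case (eng h1 h2)
      then obtain xs ys where "xs \<in> ?L" "ys \<in> ?L" "h1 = ?p xs" "h2 = ?p ys" by blast
      then show ?case using L app by (intro image_eqI[of _ _ "xs @ ys"]) auto
    qed
  qed
  show "countable (?p ` ?L)" using assms(1) by auto
qed

section \<open>The shift action and rigid configurations\<close>

lemma shift_apply [simp]:
  "k \<in> carrier G \<Longrightarrow> h \<in> carrier G \<Longrightarrow> shift G l c (k, h) = c (k, h \<otimes> l)"
  by (simp add: shift_def)

lemma shift_extensional: "shift G l c \<in> extensional (carrier G \<times> carrier G)"
  by (simp add: shift_def)

lemma shift_eq_iff: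
  assumes "d \<in> topspace (config_space G)"
  shows "shift G l c = d \<longleftrightarrow> (\<forall>g\<in>carrier G. \<forall>h\<in>carrier G. c (g, h \<otimes> l) = d (g, h))"
proof -
  have "d \<in> extensional (carrier G \<times> carrier G)"
    using assms by (auto simp: topspace_config_space PiE_def)
  then show ?thesis
    by (metis (no_types, lifting) SigmaE extensionalityI shift_apply shift_extensional)
qed

lemma config_action: "top_action G (config_space G) (shift G)"
proof
  show "continuous_map (config_space G) (config_space G) (shift G g)" if "g \<in> carrier G" for g
    unfolding config_space_def continuous_map_componentwise
  proof (intro conjI ballI)
    show "shift G g ` topspace (product_topology (\<lambda>_. discrete_topology {..<3}) (carrier G \<times> carrier G))
        \<subseteq> extensional (carrier G \<times> carrier G)"
      using shift_extensional by blast
    \<comment> \<open>Each coordinate of the shifted configuration is another coordinate of the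
      original one, hence a continuous projection.\<close>
    fix i assume "i \<in> carrier G \<times> carrier G"
    then show "continuous_map (product_topology (\<lambda>_. discrete_topology {..<3}) (carrier G \<times> carrier G))
        (discrete_topology {..<3}) (\<lambda>x. shift G g x i)"
      using that by (auto intro!: continuous_map_product_projection)
  qed
  then have closed: "shift G g x \<in> topspace (config_space G)"
    if "g \<in> carrier G" "x \<in> topspace (config_space G)" for g x
    using that by (auto simp: continuous_map_def)
  show "shift G \<one> x = x" if "x \<in> topspace (config_space G)" for x
    using that by (simp add: shift_eq_iff)
  show "shift G (g \<otimes> h) x = shift G g (shift G h x)"
    if "g \<in> carrier G" "h \<in> carrier G" "x \<in> topspace (config_space G)" for g h x
    using that by (subst shift_eq_iff) (auto simp: closed m_assoc)
qed

lemma closedin_rigid: "closedin (config_space G) (rigid G)"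
proof -
  let ?T = "config_space G"
  \<comment> \<open>The implication becomes a union of two sets, the complement of a clopen set and
    a closed set, so \<open>rigid G\<close> is an intersection of closed sets.\<close>
  have eq: "rigid G = topspace ?T \<inter> (\<Inter>k\<in>carrier G. \<Inter>l\<in>carrier G. \<Inter>g\<in>carrier G. \<Inter>h\<in>carrier G.
      (topspace ?T - {c \<in> topspace ?T. c (k, k \<otimes> l) = c (k, l)}) \<union>
      {c \<in> topspace ?T. c (g, h \<otimes> k \<otimes> l) = c (g, h \<otimes> l)})"
    unfolding rigid_def by blast
  have ne: "carrier G \<noteq> {}" by blast
  show ?thesis
    unfolding eq
    by (intro closedin_Int closedin_topspace closedin_INT ne closedin_Un closedin_diff
        clopen_config_entries_eq) auto
qed

text \<open>The variable \<open>l\<close> in \<open>rigid\<close> serves this purpose: shifting by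
  \<open>m\<close> merely replaces \<open>l\<close> by \<open>l \<otimes> m\<close>.\<close>

lemma shift_rigid:
  assumes "m \<in> carrier G" "c \<in> rigid G"
  shows "shift G m c \<in> rigid G"
proof -
  interpret top_action G "config_space G" "shift G" by (rule config_action)
  show ?thesis
    using assms act_closed[OF assms(1), of c] unfolding rigid_def by (auto simp: m_assoc)
qed

text \<open>Rigidity at \<open>l = \<one>\<close> turns agreement of the two entries into invariance
  under \<open>k\<close>. Conversely, an invariant configuration has equal entries at
  \<open>(k, \<one> \<otimes> k)\<close> and \<open>(k, \<one>)\<close>.\<close>

lemma stabilizer_rigid:
  assumes "c \<in> rigid G"
  shows "stabilizer G (shift G) c = {k \<in> carrier G. c (k, k) = c (k, \<one>)}"
proof -
  have rigid_one: "c (g, h \<otimes> k) = c (g, h)"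
    if "k \<in> carrier G" "c (k, k) = c (k, \<one>)" "g \<in> carrier G" "h \<in> carrier G" for k g h
  proof -
    have "c (k, k \<otimes> \<one>) = c (k, \<one>)" using that by simp
    then have "c (g, h \<otimes> k \<otimes> \<one>) = c (g, h \<otimes> \<one>)"
      using assms that one_closed unfolding rigid_def by blast
    then show ?thesis using that by simp
  qed
  have "shift G k c = c \<longleftrightarrow> c (k, k) = c (k, \<one>)" if k: "k \<in> carrier G" for k
  proof -
    have "c \<in> topspace (config_space G)" using assms by (simp add: rigid_def)
    then have *: "shift G k c = c \<longleftrightarrow> (\<forall>g\<in>carrier G. \<forall>h\<in>carrier G. c (g, h \<otimes> k) = c (g, h))"
      by (rule shift_eq_iff)
    have "\<forall>g\<in>carrier G. \<forall>h\<in>carrier G. c (g, h \<otimes> k) = c (g, h)" if "c (k, k) = c (k, \<one>)"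
      using assms k that rigid_one by blast
    moreover have "c (k, k) = c (k, \<one>)"
      if "\<forall>g\<in>carrier G. \<forall>h\<in>carrier G. c (g, h \<otimes> k) = c (g, h)"
      using that k by (metis l_one one_closed)
    ultimately show ?thesis using * by blast
  qed
  then show ?thesis by (auto simp: stabilizer_def)
qed

text \<open>The topology on subgroups comes from a product, so it suffices to test membership of one
  \<open>k\<close> at a time, and by \<open>stabilizer_rigid\<close> that is a clopen
  condition.\<close>

lemma continuous_map_stabilizer_rigid:
  "continuous_map (subtopology (config_space G) (rigid G)) (Sub_topology G) (stabilizer G (shift G))"
  unfolding Sub_topology_def
proof (rule continuous_map_pullback')
  interpret top_action G "config_space G" "shift G" by (rule config_action)
  let ?T = "subtopology (config_space G) (rigid G)"
  have sub: "rigid G \<subseteq> topspace (config_space G)" by (auto simp: rigid_def)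
  then have top: "topspace ?T = rigid G" by (rule topspace_subtopology_subset)
  have ga: "stabilizer G (shift G) c =
      stabilizer G (\<lambda>g. restrict (shift G g) (topspace (config_space G))) c" if "c \<in> rigid G" for c
    using sub that by (auto simp: stabilizer_def)
  show "topspace ?T \<subseteq> stabilizer G (shift G) -` {H. subgroup H G}"
    using group_action.stabilizer_subgroup[OF restrict_group_action] sub ga by (auto simp: top)
  show "continuous_map ?T (product_topology (\<lambda>_. discrete_topology UNIV) (carrier G))
      ((\<lambda>H. \<lambda>g\<in>carrier G. g \<in> H) \<circ> stabilizer G (shift G))"
    unfolding continuous_map_componentwise
  proof (intro conjI ballI)
    fix k assume k: "k \<in> carrier G"
    define A where "A = {c \<in> topspace (config_space G). c (k, k) = c (k, \<one>)}"
    have A: "openin (config_space G) A" "closedin (config_space G) A"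
      unfolding A_def using k by (auto intro!: clopen_config_entries_eq)
    have "openin ?T {c \<in> topspace ?T. (k \<in> stabilizer G (shift G) c) \<in> U}" for U
    proof -
      have "{c \<in> topspace ?T. (k \<in> stabilizer G (shift G) c) \<in> U} =
          ((if True \<in> U then A else {}) \<union> (if False \<in> U then topspace (config_space G) - A else {}))
            \<inter> rigid G"
      proof (rule Set.set_eqI)
        show "c \<in> {c \<in> topspace ?T. (k \<in> stabilizer G (shift G) c) \<in> U} \<longleftrightarrow>
          c \<in> ((if True \<in> U then A else {}) \<union> (if False \<in> U then topspace (config_space G) - A else {}))
            \<inter> rigid G" for c
          using sub k
          by (cases "c (k, k) = c (k, \<one>)") (auto simp: top A_def stabilizer_rigid)
      qed
      moreover have "openin (config_space G)
          ((if True \<in> U then A else {}) \<union> (if False \<in> U then topspace (config_space G) - A else {}))"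
        using A by auto
      ultimately show ?thesis by (auto simp: openin_subtopology)
    qed
    then show "continuous_map ?T (discrete_topology UNIV)
        (\<lambda>c. ((\<lambda>H. \<lambda>g\<in>carrier G. g \<in> H) \<circ> stabilizer G (shift G)) c k)"
      using k by (simp add: continuous_map_def)
  qed auto
qed

text \<open>If \<open>c (k, k \<otimes> l) = c (k, l)\<close>, the colouring \<open>q k\<close>
  forces \<open>k \<otimes> l\<close> and \<open>l\<close> into the same left coset of
  \<open>H\<close>. Left multiplication by any \<open>h\<close> preserves this, so all colourings
  agree there, which is rigidity. The case \<open>l = \<one>\<close> identifies the
  stabilizer.\<close>

lemma ex_rigid_stabilizer:
  assumes "subgroup H G"
  obtains c where "c \<in> rigid G" "stabilizer G (shift G) c = H"
proof -
  interpret H: subgroup H G by fact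
  define V where "V = (\<lambda>h. h <# H) ` carrier G"
  have mult: "k <# (l <# H) = (k \<otimes> l) <# H" if "k \<in> carrier G" "l \<in> carrier G" for k l
    using that by (simp add: lcos_m_assoc H.subset)
  have "\<exists>q :: 'a set \<Rightarrow> nat. (\<forall>A. q A < 3) \<and> (\<forall>A\<in>V. q (k <# A) = q A \<longrightarrow> k <# A = A)"
    if k: "k \<in> carrier G" for k
  proof -
    have "inj_on (\<lambda>A. k <# A) V"
    proof (rule inj_on_inverseI)
      fix A assume "A \<in> V"
      then show "inv k <# (k <# A) = A"
        using k by (auto simp: V_def mult simp flip: m_assoc)
    qed
    moreover have "(\<lambda>A. k <# A) ` V \<subseteq> V"
      using k by (auto simp: V_def mult)
    ultimately show ?thesis
      using injection_three_coloring by metis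
  qed
  then obtain q :: "'a \<Rightarrow> 'a set \<Rightarrow> nat" where q: "\<And>k A. k \<in> carrier G \<Longrightarrow> q k A < 3"
    "\<And>k A. k \<in> carrier G \<Longrightarrow> A \<in> V \<Longrightarrow> q k (k <# A) = q k A \<Longrightarrow> k <# A = A"
    by metis
  define c where "c = (\<lambda>(k, h)\<in>carrier G \<times> carrier G. q k (h <# H))"
  have c: "c (k, h) = q k (h <# H)" if "k \<in> carrier G" "h \<in> carrier G" for k h
    using that by (simp add: c_def)
  have fixed: "(k \<otimes> l) <# H = l <# H"
    if "k \<in> carrier G" "l \<in> carrier G" "c (k, k \<otimes> l) = c (k, l)" for k l
    using q(2)[of k "l <# H"] that by (auto simp: c mult V_def)
  have rigid: "c \<in> rigid G"
  proof -
    have "c (g, h \<otimes> k \<otimes> l) = c (g, h \<otimes> l)"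
      if "k \<in> carrier G" "l \<in> carrier G" "c (k, k \<otimes> l) = c (k, l)" "g \<in> carrier G" "h \<in> carrier G"
      for k l g h
      using fixed[OF that(1-3)] that mult[of h "k \<otimes> l"] mult[of h l] by (simp add: c m_assoc)
    moreover have "c \<in> topspace (config_space G)"
      using q(1) by (auto simp: topspace_config_space c_def)
    ultimately show ?thesis unfolding rigid_def by blast
  qed
  have "stabilizer G (shift G) c = H"
  proof (rule Set.set_eqI, rule iffI)
    fix k assume "k \<in> stabilizer G (shift G) c"
    then have "k \<in> carrier G" "c (k, k) = c (k, \<one>)" by (auto simp: stabilizer_rigid[OF rigid])
    then have "k <# H = \<one> <# H" "k \<in> carrier G" using fixed[of k \<one>] by auto
    moreover have "k \<in> k <# H" using \<open>k \<in> carrier G\<close> H.one_closed unfolding l_coset_def by force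
    ultimately show "k \<in> H" by (simp add: lcos_mult_one H.subset)
  next
    fix k assume k: "k \<in> H"
    then have "k <# H = \<one> <# H" by (simp add: lcos_mult_one H.subset coset_join3 H.subgroup_axioms)
    then show "k \<in> stabilizer G (shift G) c"
      using k by (simp add: stabilizer_rigid[OF rigid] c)
  qed
  with rigid show thesis by (rule that)
qed

end

section \<open>A minimal subsystem with stabilizers in the given URS\<close>

theorem theorem1:
  fixes G :: "('a, 'b) monoid_scheme" and Z :: "'a set set"
  assumes "group G" and "finitely_generated G" and "URS G Z"
  shows "\<exists>(M :: real metric) \<alpha>.
           minimal_system G M \<alpha> \<and> proper_system G Z M \<alpha> \<and> stability_system G M \<alpha> = Z"
proof -
  interpret group G by fact
  \<comment> \<open>Countability makes the configuration space metrizable and no larger than the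
    continuum.\<close>
  have countable: "countable (carrier G)"
    using assms(2) countable_generate unfolding finitely_generated_def
    by (metis countable_finite)
  interpret C: top_action G "config_space G" "shift G" by (rule config_action)
  let ?T = "subtopology (config_space G) (rigid G)"
  have rigid_sub: "rigid G \<subseteq> topspace (config_space G)" by (auto simp: rigid_def)
  then have top: "topspace ?T = rigid G" by (rule topspace_subtopology_subset)
  have Z: "Z \<noteq> {}" "closedin (Sub_topology G) Z"
    and conj: "\<And>g H. g \<in> carrier G \<Longrightarrow> H \<in> Z \<Longrightarrow> conj_action G g H \<in> Z"
    using assms(3) by (auto simp: URS_def)
  have Zsub: "subgroup H G" if "H \<in> Z" for H
    using that closedin_subset[OF Z(2)] by (auto simp: Sub_topology_def topspace_pullback_topology)
  \<comment> \<open>Closed by continuity of the stabilizer map, shift-invariant because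
    \<open>Z\<close> is closed under conjugation, and nonempty because every member of
    \<open>Z\<close> is the stabilizer of some rigid configuration.\<close>
  define W where "W = {c \<in> topspace ?T. stabilizer G (shift G) c \<in> Z}"
  have "closedin ?T W"
    unfolding W_def by (rule closedin_continuous_map_preimage[OF continuous_map_stabilizer_rigid Z(2)])
  then have W: "closedin (config_space G) W"
    using closedin_rigid closedin_trans_full by blast
  have W_sub: "W \<subseteq> topspace (config_space G)" by (rule closedin_subset[OF W])
  have W_inv: "shift G g c \<in> W" if "g \<in> carrier G" "c \<in> W" for g c
    using that W_sub unfolding W_def top
    by (auto simp: shift_rigid C.stabilizer_conj Zsub conj)
  have "W \<noteq> {}"
    using Z(1) Zsub ex_rigid_stabilizer unfolding W_def top by blast
  interpret W: top_action G "subtopology (config_space G) W" "shift G"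
    by (rule C.subaction) (use W_inv in auto)
  have topW: "topspace (subtopology (config_space G) W) = W"
    by (rule topspace_subtopology_subset[OF W_sub])
  have compactW: "compact_space (subtopology (config_space G) W)"
    using W compact_config_space closedin_compact_space compact_space_subtopology by blast
  obtain X where X: "closedin (subtopology (config_space G) W) X" "X \<noteq> {}"
    and X_inv: "\<And>g x. g \<in> carrier G \<Longrightarrow> x \<in> X \<Longrightarrow> shift G g x \<in> X"
    and min: "minimal_action G (subtopology (subtopology (config_space G) W) X) (shift G)"
    using W.ex_minimal_invariant[OF compactW] \<open>W \<noteq> {}\<close> unfolding topW by blast
  have XW: "X \<subseteq> W" using closedin_subset[OF X(1)] topW by simp
  then have sub: "subtopology (subtopology (config_space G) W) X = subtopology (config_space G) X"
    by (simp add: subtopology_subtopology Int_absorb1)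
  have X_closed: "closedin (config_space G) X"
    using X(1) W closedin_trans_full by blast
  have X_sub: "X \<subseteq> topspace (config_space G)" by (rule closedin_subset[OF X_closed])
  interpret X: top_action G "subtopology (config_space G) X" "shift G"
    by (rule C.subaction) (use X_inv in auto)
  have topX: "topspace (subtopology (config_space G) X) = X"
    by (rule topspace_subtopology_subset[OF X_sub])
  show ?thesis
  proof (rule X.ex_real_proper_system[OF _ _ _ _ _ _ _ assms(3)])
    show "compact_space (subtopology (config_space G) X)"
      using X_closed compact_config_space closedin_compact_space compact_space_subtopology by blast
    show "metrizable_space (subtopology (config_space G) X)"
      by (rule metrizable_space_subtopology[OF metrizable_config_space[OF countable]])
    show "topspace (subtopology (config_space G) X) \<noteq> {}" using X(2) topX by simp
    show "topspace (subtopology (config_space G) X) \<lesssim> (UNIV :: real set)"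
    proof (rule lepoll_trans[OF subset_imp_lepoll])
      show "topspace (subtopology (config_space G) X) \<subseteq> topspace (config_space G)" by auto
      show "topspace (config_space G) \<lesssim> (UNIV :: real set)"
        unfolding topspace_config_space using countable by (intro countable_PiE_lepoll_real) auto
    qed
    show "minimal_action G (subtopology (config_space G) X) (shift G)"
      using min by (simp only: sub)
    show "stabilizer G (shift G) x \<in> Z" if "x \<in> topspace (subtopology (config_space G) X)" for x
      using that XW topX by (auto simp: W_def)
    fix g assume g: "g \<in> carrier G"
    \<comment> \<open>On \<open>X\<close> the fixed-point set of \<open>g\<close> is thus the trace
      of a clopen set, which supplies the openness required by
      \<open>ex_real_proper_system\<close>.\<close>
    have "shift G g x = x \<longleftrightarrow> x (g, g) = x (g, \<one>\<^bsub>G\<^esub>)" if "x \<in> X" for x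
      using that XW stabilizer_rigid[of x] g by (auto simp: W_def stabilizer_def top)
    then have "{x \<in> topspace (subtopology (config_space G) X). shift G g x = x} =
        {c \<in> topspace (config_space G). c (g, g) = c (g, \<one>\<^bsub>G\<^esub>)} \<inter> X"
      using X_sub unfolding topX by blast
    then show "openin (subtopology (config_space G) X)
        {x \<in> topspace (subtopology (config_space G) X). shift G g x = x}"
      using clopen_config_entries_eq(1)[of "(g, g)" G "(g, \<one>\<^bsub>G\<^esub>)"] g
      by (auto simp: openin_subtopology)
  qed
qed

end
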